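(* Fix a constant $0<\beta<1$ and a map $K:\mathbb{N}\to\mathbb{N}$. Let $(G,\subseteq,\prec)$ be a $K$-intersecting $2$-incomparable graph with $|V(G)|=n$. If $\alpha(G)\ge \beta n$, then $h(G)\le 2\sqrt{\frac{1-\beta}{\beta}\,n\,K(n)}$. In particular, $h(G)=o(n)$ if $K(n)=o(n)$.
   Context: For a graph $G$ and two partial orders $\subseteq$ and $\prec$ on $V(G)$, $(G,\subseteq,\prec)$ is a $2$-incomparable graph if for any distinct vertices $a,b,c$: (i) $ab\in E(G)$ iff $a,b$ are incomparable in both $\subseteq$ and $\prec$; (ii) if $a\subseteq b$ then $a,b$ are incomparable in $\prec$; (iii) if $a\prec b$ then $a,b$ are incomparable in $\subseteq$; (iv) if $a\prec b$ and $c\subseteq a$ then $c\prec b$; (v) if $a\prec b$ and $c\subseteq b$ then $a\prec c$. Such a graph is $K$-intersecting if for every chain $a_1\prec a_2\prec\cdots\prec a_\ell$ and every $x\in V(G)\setminus\{a_1,\dots,a_\ell\}$, $|N(x)\cap\{a_1,\dots,a_\ell\}|\le K(|V(G)|)$. $\alpha(G)$ is the independence number. A hitting set of $G$ is a set $T\subseteq V(G)$ meeting every maximum independent set; $h(G)$ is its minimum size.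
   Formalization: For G without edges, the first bound is stated only when its right-hand side is at least 1: an edgeless nonempty G has h(G)=1, so the claim fails otherwise (e.g. one vertex, K=0), and for the empty graph h(G) is undefined. The o(n) part has no such restriction. *)

theory Defs
  imports Complex_Main "HOL-Library.Landau_Symbols"
begin

locale simple_graph =
  fixes V :: "'a set" and E :: "'a set set"
  assumes finite_V: "finite V"
    and edges: "E \<subseteq> {{a, b} | a b. a \<in> V \<and> b \<in> V \<and> a \<noteq> b}"

definition neighbours :: "'a set set \<Rightarrow> 'a \<Rightarrow> 'a set" where
  "neighbours E x = {y. {x, y} \<in> E}"

definition independent_set :: "'a set \<Rightarrow> 'a set set \<Rightarrow> 'a set \<Rightarrow> bool" where
  "independent_set V E I \<longleftrightarrow> I \<subseteq> V \<and> (\<forall>a\<in>I. \<forall>b\<in>I. {a, b} \<notin> E)"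

definition independence_number :: "'a set \<Rightarrow> 'a set set \<Rightarrow> nat" where
  "independence_number V E = Max (card ` {I. independent_set V E I})"

definition maximum_independent_set :: "'a set \<Rightarrow> 'a set set \<Rightarrow> 'a set \<Rightarrow> bool" where
  "maximum_independent_set V E I \<longleftrightarrow>
     independent_set V E I \<and> card I = independence_number V E"

definition hitting_set :: "'a set \<Rightarrow> 'a set set \<Rightarrow> 'a set \<Rightarrow> bool" where
  "hitting_set V E T \<longleftrightarrow>
     T \<subseteq> V \<and> (\<forall>I. maximum_independent_set V E I \<longrightarrow> T \<inter> I \<noteq> {})"

(* For finite nonempty V the set V itself is hitting, so the minimum exists. For V = {} the
   only maximum independent set is {}, no hitting set exists and the value is unspecified. *)
definition hitting_number :: "'a set \<Rightarrow> 'a set set \<Rightarrow> nat" where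
  "hitting_number V E = Min (card ` {T. hitting_set V E T})"

definition incomparable :: "('a \<Rightarrow> 'a \<Rightarrow> bool) \<Rightarrow> 'a \<Rightarrow> 'a \<Rightarrow> bool" where
  "incomparable R a b \<longleftrightarrow> \<not> R a b \<and> \<not> R b a"

(* The order \<sqsubseteq> is the reflexive one (written as inclusion on paper) and \<prec> the strict
   one. Since the axioms only concern distinct vertices, nothing depends on this choice. *)
locale two_incomparable_graph = simple_graph V E
  for V :: "'a set" and E :: "'a set set" +
  fixes sub :: "'a \<Rightarrow> 'a \<Rightarrow> bool" (infix "\<sqsubseteq>" 50)
    and prec :: "'a \<Rightarrow> 'a \<Rightarrow> bool" (infix "\<prec>" 50)
  assumes sub_order: "reflp_on V (\<sqsubseteq>)" "antisymp_on V (\<sqsubseteq>)" "transp_on V (\<sqsubseteq>)"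
    and prec_order: "irreflp_on V (\<prec>)" "transp_on V (\<prec>)"
    and edge_iff: "\<lbrakk>a \<in> V; b \<in> V; a \<noteq> b\<rbrakk> \<Longrightarrow>
      {a, b} \<in> E \<longleftrightarrow> incomparable (\<sqsubseteq>) a b \<and> incomparable (\<prec>) a b"
    and sub_incomparable: "\<lbrakk>a \<in> V; b \<in> V; a \<noteq> b; a \<sqsubseteq> b\<rbrakk> \<Longrightarrow> incomparable (\<prec>) a b"
    and prec_incomparable: "\<lbrakk>a \<in> V; b \<in> V; a \<noteq> b; a \<prec> b\<rbrakk> \<Longrightarrow> incomparable (\<sqsubseteq>) a b"
    and sub_prec_left: "\<lbrakk>a \<in> V; b \<in> V; c \<in> V; distinct [a, b, c]; a \<prec> b; c \<sqsubseteq> a\<rbrakk> \<Longrightarrow> c \<prec> b"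
    and sub_prec_right: "\<lbrakk>a \<in> V; b \<in> V; c \<in> V; distinct [a, b, c]; a \<prec> b; c \<sqsubseteq> b\<rbrakk> \<Longrightarrow> a \<prec> c"

locale intersecting_two_incomparable_graph = two_incomparable_graph V E sub prec
  for V :: "'a set" and E :: "'a set set"
    and sub :: "'a \<Rightarrow> 'a \<Rightarrow> bool" (infix "\<sqsubseteq>" 50)
    and prec :: "'a \<Rightarrow> 'a \<Rightarrow> bool" (infix "\<prec>" 50) +
  fixes K :: "nat \<Rightarrow> nat"
  assumes intersecting: "\<lbrakk>set as \<subseteq> V; successively (\<prec>) as; x \<in> V - set as\<rbrakk> \<Longrightarrow>
      card (neighbours E x \<inter> set as) \<le> K (card V)"

end

theory Submission
  imports Defs
begin

text \<open>
  Call an independent set layered by \<open>k\<close> levels if it splits into \<open>k\<close> antichains of \<open>\<sqsubseteq>\<close>; each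
  of these is a \<open>\<prec>\<close>-chain, so an outside vertex has at most \<open>k K(n)\<close> neighbours in the set. Let
  \<open>t\<close> be the least number of levels of a maximum independent set, and let \<open>g x\<close> be the
  corresponding number for the graph induced on the vertices strictly below \<open>x\<close>. Along
  \<open>\<sqsubseteq>\<close>, the function \<open>g\<close> cannot skip a value on a maximum independent set, so for every
  \<open>i < t\<close> the fibre \<open>g = i\<close> is a hitting set. These fibres are disjoint, whence \<open>t h \<le> n\<close>.
  On the other hand, in a maximum independent set with \<open>t\<close> levels, some vertex has degree at most
  \<open>(n - \<alpha>) t K(n) / \<alpha>\<close>, and its closed neighbourhood is a hitting set. Multiplying the two bounds
  gives \<open>h (h - 1) \<le> (1 - \<beta>) / \<beta> n K(n)\<close>.
\<close>

section \<open>Chains as lists, maximum independent sets, hitting sets\<close>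

text \<open>The axiom \<open>intersecting\<close> speaks of lists, so sets of pairwise comparable
  vertices must be enumerated. A minimal element precedes all the others and becomes the
  head.\<close>

lemma finite_chain_list:
  assumes "finite A" and "A \<subseteq> V" and "irreflp_on V R" and "transp_on V R"
    and "\<And>a b. a \<in> A \<Longrightarrow> b \<in> A \<Longrightarrow> a \<noteq> b \<Longrightarrow> R a b \<or> R b a"
  shows "\<exists>as. set as = A \<and> sorted_wrt R as"
  using assms(1,2,5)
proof (induction A rule: finite_psubset_induct)
  case (psubset A)
  show ?case
  proof (cases "A = {}")
    case False
    have trans: "transp_on A R" and irrefl: "irreflp_on A R"
      using assms(3,4) psubset.prems(1) by (auto intro: transp_on_subset irreflp_on_subset)
    then have "asymp_on A R"
      by (metis asymp_onI irreflp_onD transp_onD)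
    with trans False psubset.hyps obtain m where m: "m \<in> A" "\<forall>x\<in>A. x \<noteq> m \<longrightarrow> \<not> R x m"
      using Finite_Set.bex_min_element by (metis (full_types))
    obtain as where as: "set as = A - {m}" "sorted_wrt R as"
      using psubset.IH[of "A - {m}"] psubset.prems m(1) by blast
    have "sorted_wrt R (m # as)"
      using as m psubset.prems(2) by auto
    moreover have "set (m # as) = A"
      using as(1) m(1) by auto
    ultimately show ?thesis by blast
  qed auto
qed

lemma finite_independent_sets: "finite V \<Longrightarrow> finite {I. independent_set V E I}"
  by (rule finite_subset[of _ "Pow V"]) (auto simp: independent_set_def)

lemma card_le_independence_number:
  "finite V \<Longrightarrow> independent_set V E I \<Longrightarrow> card I \<le> independence_number V E"
  unfolding independence_number_def by (rule Max_ge) (auto simp: finite_independent_sets)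

lemma ex_maximum_independent_set:
  assumes "finite V"
  obtains I where "maximum_independent_set V E I"
proof -
  have "independent_set V E {}"
    by (auto simp: independent_set_def)
  then have "independence_number V E \<in> card ` {I. independent_set V E I}"
    unfolding independence_number_def
    by (intro Max_in) (auto simp: finite_independent_sets assms)
  then show ?thesis
    using that by (auto simp: maximum_independent_set_def)
qed

lemma maximum_independent_setI:
  assumes "finite V" "maximum_independent_set V E J" "independent_set V E I" "card J \<le> card I"
  shows "maximum_independent_set V E I"
  using assms card_le_independence_number[OF assms(1,3)]
  by (auto simp: maximum_independent_set_def)

lemma hitting_number_le:
  assumes "finite V" "hitting_set V E T"
  shows "hitting_number V E \<le> card T"
proof -
  have "finite {T. hitting_set V E T}"
    by (rule finite_subset[of _ "Pow V"]) (auto simp: hitting_set_def assms(1))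
  then show ?thesis
    unfolding hitting_number_def using assms(2) by (auto intro: Min_le)
qed

context simple_graph
begin

lemma neighbours_subset: "neighbours E v \<subseteq> V"
  using edges by (auto simp: neighbours_def doubleton_eq_iff)

lemma not_self_edge: "{a} \<notin> E"
  using edges by (auto simp: doubleton_eq_iff singleton_insert_inj_eq')

text \<open>A maximum independent set disjoint from the closed neighbourhood of \<open>v\<close>
  could be enlarged by \<open>v\<close>.\<close>

lemma hitting_set_insert_neighbours:
  assumes "v \<in> V"
  shows "hitting_set V E (insert v (neighbours E v))"
  unfolding hitting_set_def
proof (intro conjI allI impI)
  show "insert v (neighbours E v) \<subseteq> V"
    using assms neighbours_subset by auto
  fix I assume I: "maximum_independent_set V E I"
  show "insert v (neighbours E v) \<inter> I \<noteq> {}"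
  proof
    assume disj: "insert v (neighbours E v) \<inter> I = {}"
    then have edge: "{v, x} \<notin> E" "{x, v} \<notin> E" if "x \<in> I" for x
      using that by (auto simp: neighbours_def insert_commute)
    have "independent_set V E (insert v I)"
      using I assms edge not_self_edge
      by (auto simp: maximum_independent_set_def independent_set_def)
    then have "card (insert v I) \<le> card I"
      using I card_le_independence_number[OF finite_V] by (simp add: maximum_independent_set_def)
    moreover have "finite I"
      using I finite_V by (auto simp: maximum_independent_set_def independent_set_def
          intro: finite_subset)
    ultimately show False
      using disj by simp
  qed
qed

end

section \<open>Comparability and layers\<close>

context two_incomparable_graph
begin

lemma independent_set_iff:
  assumes "D \<subseteq> V"
  shows "independent_set D E I \<longleftrightarrow> I \<subseteq> D \<and>
    (\<forall>a\<in>I. \<forall>b\<in>I. a \<noteq> b \<longrightarrow> a \<sqsubseteq> b \<or> b \<sqsubseteq> a \<or> a \<prec> b \<or> b \<prec> a)"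
proof -
  have "{a, b} \<notin> E \<longleftrightarrow> a = b \<or> a \<sqsubseteq> b \<or> b \<sqsubseteq> a \<or> a \<prec> b \<or> b \<prec> a" if "a \<in> V" "b \<in> V" for a b
    using edge_iff[OF that] not_self_edge by (cases "a = b") (auto simp: incomparable_def)
  then show ?thesis
    using assms unfolding independent_set_def by (metis subset_eq)
qed

lemma sub_trans: "\<lbrakk>a \<in> V; b \<in> V; c \<in> V; a \<sqsubseteq> b; b \<sqsubseteq> c\<rbrakk> \<Longrightarrow> a \<sqsubseteq> c"
  using sub_order(3) by (meson transp_onD)

lemma sub_antisym: "\<lbrakk>a \<in> V; b \<in> V; a \<sqsubseteq> b; b \<sqsubseteq> a\<rbrakk> \<Longrightarrow> a = b"
  using sub_order(2) by (meson antisymp_onD)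

lemma sub_refl: "a \<in> V \<Longrightarrow> a \<sqsubseteq> a"
  using sub_order(1) by (meson reflp_onD)

lemma prec_irrefl: "a \<in> V \<Longrightarrow> \<not> a \<prec> a"
  using prec_order(1) by (meson irreflp_onD)

lemma prec_not_sub: "\<lbrakk>a \<in> V; b \<in> V; a \<prec> b\<rbrakk> \<Longrightarrow> \<not> a \<sqsubseteq> b \<and> \<not> b \<sqsubseteq> a"
  using prec_incomparable prec_irrefl unfolding incomparable_def by metis

text \<open>Axioms (iv) and (v) are applied in turn. A coincidence \<open>c = b\<close> or
  \<open>d = c\<close> would make two vertices comparable in both orders, so distinctness comes for
  free. The lemma lets \<open>\<prec>\<close> pass from two vertices to everything below
  them.\<close>

lemma prec_mono:
  assumes "a \<in> V" "b \<in> V" "c \<in> V" "d \<in> V" "a \<prec> b" "c \<sqsubseteq> a" "d \<sqsubseteq> b"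
  shows "c \<prec> d"
proof -
  have "c \<noteq> b" "a \<noteq> b" using assms prec_not_sub prec_irrefl by blast+
  then have cb: "c \<prec> b" using sub_prec_left[of a b c] assms by (cases "c = a") auto
  then have "d \<noteq> c" using assms prec_not_sub by blast
  then show ?thesis using sub_prec_right[of c b d] assms cb \<open>c \<noteq> b\<close> by (cases "d = b") auto
qed

definition below :: "'a \<Rightarrow> 'a set" where
  "below x = {y \<in> V. y \<sqsubseteq> x \<and> y \<noteq> x}"

text \<open>The rank \<open>r\<close> increases strictly along \<open>\<sqsubseteq>\<close>, so its
  fibres are the \<open>k\<close> antichains. In this form a further vertex is put on top by giving
  it a larger value.\<close>

definition layered :: "nat \<Rightarrow> 'a set \<Rightarrow> bool" where
  "layered k I \<longleftrightarrow> (\<exists>r. (\<forall>x\<in>I. r x < k) \<and> (\<forall>x\<in>I. \<forall>y\<in>I. x \<sqsubseteq> y \<longrightarrow> x \<noteq> y \<longrightarrow> r x < r y))"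

definition layer_number :: "'a set \<Rightarrow> nat" where
  "layer_number D = (LEAST k. \<exists>I. maximum_independent_set D E I \<and> layered k I)"

lemma below_subset: "below x \<subseteq> V"
  by (auto simp: below_def)

lemma below_mono: "x \<in> V \<Longrightarrow> y \<in> below x \<Longrightarrow> below y \<subseteq> below x"
  unfolding below_def using sub_trans[of _ y x] sub_antisym[of x y] by blast

text \<open>Serves only to make the \<open>LEAST\<close> in \<open>layer_number\<close> attained.
  The rank of a vertex is the number of vertices of \<open>I\<close> strictly below it.\<close>

lemma layered_card_below:
  assumes "finite I" "I \<subseteq> V"
  shows "layered (Suc (card I)) I"
  unfolding layered_def
proof (intro exI[of _ "\<lambda>x. card (I \<inter> below x)"] conjI ballI impI)
  show "card (I \<inter> below x) < Suc (card I)" for x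
    using assms by (auto simp: less_Suc_eq_le intro: card_mono)
  fix x y assume xy: "x \<in> I" "y \<in> I" "x \<sqsubseteq> y" "x \<noteq> y"
  then have "x \<in> I \<inter> below y" "x \<notin> below x" "below x \<subseteq> below y"
    using assms below_mono[of y x] by (auto simp: below_def)
  then have "I \<inter> below x \<subset> I \<inter> below y" by blast
  then show "card (I \<inter> below x) < card (I \<inter> below y)"
    using assms by (auto intro: psubset_card_mono)
qed

lemma layer_number_attained:
  assumes "D \<subseteq> V"
  obtains I where "maximum_independent_set D E I" "layered (layer_number D) I"
proof -
  have fin: "finite D" using assms finite_V finite_subset by blast
  obtain I where I: "maximum_independent_set D E I" using ex_maximum_independent_set[OF fin] .
  then have "I \<subseteq> D" by (auto simp: maximum_independent_set_def independent_set_def)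
  then have "layered (Suc (card I)) I"
    using assms fin by (intro layered_card_below) (auto intro: finite_subset)
  with I have "\<exists>k I. maximum_independent_set D E I \<and> layered k I" by blast
  from LeastI_ex[OF this] show ?thesis
    using that unfolding layer_number_def by blast
qed

section \<open>Exchanging maximum independent sets below a vertex\<close>

text \<open>Any independent set \<open>I\<close> of \<open>below x\<close> can replace
  \<open>J \<inter> below x\<close> in \<open>J\<close>: a vertex of \<open>J\<close> outside
  \<open>below x\<close> is comparable to \<open>x\<close>, and this comparability passes to all
  vertices below \<open>x\<close>. Maximality of \<open>J\<close> then bounds the size of
  \<open>I\<close>.\<close>

lemma maximum_independent_set_below:
  assumes "D \<subseteq> V" and J: "maximum_independent_set D E J" and x: "x \<in> J" and down: "below x \<subseteq> D"
  shows "maximum_independent_set (below x) E (J \<inter> below x)"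
proof -
  have fin: "finite D" "finite (below x)" using assms(1) finite_V finite_subset below_subset by blast+
  obtain I where I: "maximum_independent_set (below x) E I"
    using ex_maximum_independent_set[OF fin(2)] .
  have J': "J \<subseteq> D" "\<And>a b. a \<in> J \<Longrightarrow> b \<in> J \<Longrightarrow> a \<noteq> b \<Longrightarrow> a \<sqsubseteq> b \<or> b \<sqsubseteq> a \<or> a \<prec> b \<or> b \<prec> a"
    using J independent_set_iff[OF assms(1)] by (auto simp: maximum_independent_set_def)
  have I': "I \<subseteq> below x" "\<And>a b. a \<in> I \<Longrightarrow> b \<in> I \<Longrightarrow> a \<noteq> b \<Longrightarrow> a \<sqsubseteq> b \<or> b \<sqsubseteq> a \<or> a \<prec> b \<or> b \<prec> a"
    using I independent_set_iff[OF below_subset] by (auto simp: maximum_independent_set_def)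
  have xV: "x \<in> V" using x J' assms(1) by blast
  have mixed: "a \<sqsubseteq> b \<or> b \<sqsubseteq> a \<or> a \<prec> b \<or> b \<prec> a" if a: "a \<in> I" and b: "b \<in> J - below x" for a b
  proof -
    have aV: "a \<in> V" "a \<sqsubseteq> x" and bV: "b \<in> V" using I' a b J' assms(1) by (auto simp: below_def)
    \<comment> \<open>The remaining possibility, \<open>b \<sqsubseteq> x\<close> with
      \<open>b \<noteq> x\<close>, would put \<open>b\<close> into \<open>below x\<close>.\<close>
    consider "b = x" | "x \<sqsubseteq> b" | "x \<prec> b" | "b \<prec> x"
      using J'(2)[OF x, of b] b bV by (auto simp: below_def)
    then show ?thesis
      using aV bV xV sub_trans[of a x b] prec_mono[of x b a b] prec_mono[of b x b a] sub_refl
      by cases auto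
  qed
  have "independent_set D E ((J - below x) \<union> I)"
    unfolding independent_set_iff[OF assms(1)] using J' I' mixed down by blast
  then have "card ((J - below x) \<union> I) \<le> card J"
    using J card_le_independence_number[OF fin(1)] by (simp add: maximum_independent_set_def)
  moreover have finJ: "finite J" "finite I" using J' I' fin finite_subset by blast+
  moreover have "card ((J - below x) \<union> I) = card (J - below x) + card I"
    using finJ I' by (intro card_Un_disjoint) auto
  moreover have "card J = card (J - below x) + card (J \<inter> below x)"
    using finJ by (metis add.commute card_Int_Diff)
  ultimately have "card I \<le> card (J \<inter> below x)" by simp
  moreover have "independent_set (below x) E (J \<inter> below x)"
    using J' unfolding independent_set_iff[OF below_subset] by blast
  ultimately show ?thesis
    using maximum_independent_setI[OF fin(2) I] by blast
qed

text \<open>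
  Below each \<open>\<sqsubseteq>\<close>-maximal vertex \<open>y\<close> of \<open>J\<close>, the set \<open>J\<close> is exchanged for a maximum independent
  set of \<open>below y\<close> with the fewest layers. Distinct maximal vertices of \<open>J\<close> are
  \<open>\<prec>\<close>-comparable, and this is inherited by everything below them.
\<close>
lemma layer_number_le:
  assumes D: "D \<subseteq> V" and down: "\<And>y. y \<in> D \<Longrightarrow> below y \<subseteq> D"
    and J: "maximum_independent_set D E J"
    and less: "\<And>y. y \<in> J \<Longrightarrow> layer_number (below y) < k"
  shows "layer_number D \<le> k"
proof -
  have fin: "finite D" using D finite_V finite_subset by blast
  have J': "J \<subseteq> D" "\<And>a b. a \<in> J \<Longrightarrow> b \<in> J \<Longrightarrow> a \<noteq> b \<Longrightarrow> a \<sqsubseteq> b \<or> b \<sqsubseteq> a \<or> a \<prec> b \<or> b \<prec> a"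
    using J independent_set_iff[OF D] by (auto simp: maximum_independent_set_def)
  have finJ: "finite J" using J' fin finite_subset by blast
  define M where "M = {y \<in> J. \<forall>z\<in>J. y \<sqsubseteq> z \<longrightarrow> y = z}"
  have MV: "y \<in> V" "y \<in> J" "y \<in> D" if "y \<in> M" for y using that J' D by (auto simp: M_def)
  have finM: "finite M" using finJ by (simp add: M_def)
  have "\<forall>y. \<exists>I. maximum_independent_set (below y) E I \<and> layered (layer_number (below y)) I"
    using layer_number_attained[OF below_subset] by metis
  then obtain I where I: "\<And>y. maximum_independent_set (below y) E (I y)"
      "\<And>y. layered (layer_number (below y)) (I y)" by metis
  have I_below: "I y \<subseteq> below y"
    and I_ind: "\<And>a b. a \<in> I y \<Longrightarrow> b \<in> I y \<Longrightarrow> a \<noteq> b \<Longrightarrow> a \<sqsubseteq> b \<or> b \<sqsubseteq> a \<or> a \<prec> b \<or> b \<prec> a" for y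
    using I(1)[of y] independent_set_iff[OF below_subset]
    by (auto simp: maximum_independent_set_def)
  have finI: "finite (I y)" for y
    using I_below below_subset finite_V by (meson finite_subset)
  obtain r where r: "\<And>y x. x \<in> I y \<Longrightarrow> r y x < layer_number (below y)"
      "\<And>y x z. x \<in> I y \<Longrightarrow> z \<in> I y \<Longrightarrow> x \<sqsubseteq> z \<Longrightarrow> x \<noteq> z \<Longrightarrow> r y x < r y z"
    using I(2) unfolding layered_def by metis
  define P where "P y = insert y (I y)" for y
  have P: "a \<in> V" "a \<sqsubseteq> y" "a \<in> D" if "a \<in> P y" "y \<in> M" for a y
    using that I_below[of y] MV[OF that(2)] down[of y] sub_refl
    by (auto simp: P_def below_def)
  have cross: "a \<prec> b \<or> b \<prec> a" if "y \<in> M" "z \<in> M" "y \<noteq> z" "a \<in> P y" "b \<in> P z" for y z a b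
  proof -
    have "y \<prec> z \<or> z \<prec> y" using that J'(2)[of y z] by (auto simp: M_def)
    then show ?thesis using prec_mono P MV that by meson
  qed
  have cross': "\<not> a \<sqsubseteq> b" if "y \<in> M" "z \<in> M" "y \<noteq> z" "a \<in> P y" "b \<in> P z" for y z a b
    using cross[OF that] prec_not_sub P that by blast
  \<comment> \<open>Blocks \<open>P y\<close> of distinct maximal vertices are disjoint, because a
    common vertex \<open>a\<close> would violate \<open>cross'\<close> through
    \<open>a \<sqsubseteq> a\<close>. Hence on \<open>J2\<close> the choice is forced:
    \<open>top a\<close> is the maximal vertex whose block contains \<open>a\<close>.\<close>
  define top where "top a = (SOME y. y \<in> M \<and> a \<in> P y)" for a
  have top: "top a = y" if "y \<in> M" "a \<in> P y" for a y
  proof -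
    have "top a \<in> M \<and> a \<in> P (top a)" unfolding top_def by (rule someI) (use that in blast)
    then show ?thesis using cross'[of "top a" y a a] that P sub_refl by blast
  qed
  define J2 where "J2 = (\<Union>y\<in>M. P y)"
  have ind: "independent_set D E J2"
    unfolding independent_set_iff[OF D]
  proof (intro conjI ballI impI)
    show "J2 \<subseteq> D" using P by (auto simp: J2_def)
    fix a b assume "a \<in> J2" "b \<in> J2" "a \<noteq> b"
    then obtain y z where yz: "y \<in> M" "a \<in> P y" "z \<in> M" "b \<in> P z" by (auto simp: J2_def)
    show "a \<sqsubseteq> b \<or> b \<sqsubseteq> a \<or> a \<prec> b \<or> b \<prec> a"
    proof (cases "y = z")
      case True
      then show ?thesis using yz I_ind[of a y b] P[of a y] P[of b y] \<open>a \<noteq> b\<close>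
        by (auto simp: P_def)
    next
      case False
      then show ?thesis using cross yz by blast
    qed
  qed
  \<comment> \<open>A maximal element of the part of \<open>J\<close> above \<open>j\<close> is
    maximal in all of \<open>J\<close>, by transitivity. The strict part of
    \<open>\<sqsubseteq>\<close> supplies the asymmetric relation required for picking it.\<close>
  have "J \<subseteq> (\<Union>y\<in>M. insert y (J \<inter> below y))"
  proof
    fix j assume j: "j \<in> J"
    let ?U = "{z \<in> J. j \<sqsubseteq> z}"
    have "\<exists>m\<in>?U. \<forall>x\<in>?U. x \<noteq> m \<longrightarrow> \<not> (m \<sqsubseteq> x \<and> m \<noteq> x)"
    proof (rule Finite_Set.bex_max_element)
      show "finite ?U" using finJ by simp
      show "?U \<noteq> {}" using j J' D sub_refl by blast
      show "asymp_on ?U (\<lambda>m x. m \<sqsubseteq> x \<and> m \<noteq> x)"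
        using J'(1) D sub_antisym by (intro asymp_onI) blast
      show "transp_on ?U (\<lambda>m x. m \<sqsubseteq> x \<and> m \<noteq> x)"
      proof (intro transp_onI conjI)
        fix a b c assume "a \<in> ?U" "b \<in> ?U" "c \<in> ?U" "a \<sqsubseteq> b \<and> a \<noteq> b" "b \<sqsubseteq> c \<and> b \<noteq> c"
        moreover from this have "a \<in> V" "b \<in> V" "c \<in> V" using J'(1) D by auto
        ultimately show "a \<sqsubseteq> c" "a \<noteq> c"
          using sub_trans[of a b c] sub_antisym[of a b] by auto
      qed
    qed
    then obtain m where "m \<in> ?U" and max: "\<forall>x\<in>?U. x \<noteq> m \<longrightarrow> \<not> (m \<sqsubseteq> x \<and> m \<noteq> x)"
      by (rule bexE)
    then have m: "m \<in> J" "j \<sqsubseteq> m" by simp_all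
    have "m = x" if "x \<in> J" "m \<sqsubseteq> x" for x
    proof -
      have "j \<in> V" "m \<in> V" "x \<in> V" using j m(1) that(1) J'(1) D by auto
      then have "j \<sqsubseteq> x" using sub_trans m(2) that(2) by blast
      then show ?thesis using max that by auto
    qed
    then have "m \<in> M" using m(1) by (simp add: M_def)
    moreover have "j \<in> insert m (J \<inter> below m)" using m j J' D by (auto simp: below_def)
    ultimately show "j \<in> (\<Union>y\<in>M. insert y (J \<inter> below y))" by blast
  qed
  \<comment> \<open>\<open>J \<inter> below y\<close> and \<open>I y\<close> are both maximum in
    \<open>below y\<close>, so each new block is as large as the old one. The new blocks are
    disjoint, whence \<open>J2\<close> has at least as many vertices as \<open>J\<close>.\<close>
  then have "card J \<le> card (\<Union>y\<in>M. insert y (J \<inter> below y))"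
    using finM finJ by (intro card_mono) auto
  also have "\<dots> \<le> (\<Sum>y\<in>M. card (insert y (J \<inter> below y)))"
    by (rule card_UN_le[OF finM])
  also have "\<dots> \<le> (\<Sum>y\<in>M. card (P y))"
  proof (rule sum_mono)
    fix y assume y: "y \<in> M"
    have "maximum_independent_set (below y) E (J \<inter> below y)"
      using maximum_independent_set_below[OF D J] MV[OF y] down by blast
    then have "card (J \<inter> below y) = card (I y)"
      using I(1)[of y] by (simp add: maximum_independent_set_def)
    moreover have "y \<notin> below y" by (simp add: below_def)
    moreover have "y \<notin> I y" using I_below \<open>y \<notin> below y\<close> by blast
    ultimately show "card (insert y (J \<inter> below y)) \<le> card (P y)"
      using finJ finI by (simp add: P_def)
  qed
  also have "\<dots> = card J2"
    unfolding J2_def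
  proof (rule card_UN_disjoint[symmetric])
    show "\<forall>y\<in>M. \<forall>z\<in>M. y \<noteq> z \<longrightarrow> P y \<inter> P z = {}" using top by blast
  qed (use finM finI in \<open>auto simp: P_def\<close>)
  finally have max: "maximum_independent_set D E J2"
    using maximum_independent_setI[OF fin J ind] by blast
  \<comment> \<open>Inside the block of \<open>y\<close> the ranks below \<open>y\<close> are
    smaller than \<open>layer_number (below y)\<close>, so this number itself can be the rank of
    \<open>y\<close>, and it is less than \<open>k\<close>. Different blocks impose no condition on
    each other, by \<open>cross'\<close>.\<close>
  have "layered k J2"
    unfolding layered_def
  proof (intro exI[of _ "\<lambda>a. if a = top a then layer_number (below a) else r (top a) a"]
      conjI ballI impI)
    fix a assume "a \<in> J2"
    then obtain y where y: "y \<in> M" "a \<in> P y" by (auto simp: J2_def)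
    have "layer_number (below y) < k" using less MV y by blast
    then show "(if a = top a then layer_number (below a) else r (top a) a) < k"
      using y top[OF y] r(1)[of a y] by (auto simp: P_def)
  next
    fix a b assume ab: "a \<in> J2" "b \<in> J2" "a \<sqsubseteq> b" "a \<noteq> b"
    then obtain y z where yz: "y \<in> M" "a \<in> P y" "z \<in> M" "b \<in> P z" by (auto simp: J2_def)
    have "y = z" using cross' yz ab by blast
    then have "a \<noteq> y" using P(1,2)[OF yz(4,3)] P(1)[OF yz(2,1)] ab sub_antisym by blast
    then show "(if a = top a then layer_number (below a) else r (top a) a)
        < (if b = top b then layer_number (below b) else r (top b) b)"
      using yz ab top[OF yz(1,2)] top[OF yz(3,4)] r \<open>y = z\<close> by (auto simp: P_def)
  qed
  with max show ?thesis
    unfolding layer_number_def by (intro Least_le) blast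
qed

section \<open>Fibres of the layer number as hitting sets\<close>

text \<open>Suppose \<open>J\<close> misses the fibre of \<open>i\<close>. If all vertices of
  \<open>J\<close> below \<open>x\<close> have values less than \<open>i\<close>, then
  \<open>layer_number_le\<close> gives \<open>x\<close> a value at most \<open>i\<close>, and
  \<open>i\<close> itself is excluded. So all of \<open>J\<close> stays below \<open>i\<close>, and
  \<open>layer_number_le\<close> for \<open>V\<close> contradicts the choice of
  \<open>i\<close>.\<close>

lemma hitting_set_layer:
  assumes i: "i < layer_number V"
  shows "hitting_set V E {x \<in> V. layer_number (below x) = i}"
  unfolding hitting_set_def
proof (intro conjI allI impI)
  fix J assume J: "maximum_independent_set V E J"
  then have JV: "J \<subseteq> V" by (simp add: maximum_independent_set_def independent_set_def)
  show "{x \<in> V. layer_number (below x) = i} \<inter> J \<noteq> {}"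
  proof
    assume none: "{x \<in> V. layer_number (below x) = i} \<inter> J = {}"
    have "layer_number (below x) < i" if "x \<in> J" for x
      using that
    proof (induction "card (below x)" arbitrary: x rule: less_induct)
      case less
      have xV: "x \<in> V" using less.prems JV by blast
      have "layer_number (below x) \<le> i"
      proof (rule layer_number_le[OF below_subset])
        show "below y \<subseteq> below x" if "y \<in> below x" for y
          using below_mono xV that .
        show "maximum_independent_set (below x) E (J \<inter> below x)"
          using maximum_independent_set_below[OF _ J less.prems below_subset] by simp
        fix y assume y: "y \<in> J \<inter> below x"
        then have "below y \<subset> below x"
          using below_mono[OF xV, of y] by (auto simp: below_def)
        then have "card (below y) < card (below x)"
          using finite_V below_subset by (meson finite_subset psubset_card_mono)
        then show "layer_number (below y) < i"
          using less.hyps y by blast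
      qed
      moreover have "layer_number (below x) \<noteq> i" using none less.prems xV by blast
      ultimately show ?case by simp
    qed
    then have "layer_number V \<le> i"
      using layer_number_le[OF _ below_subset J] by blast
    with i show False by simp
  qed
qed auto

lemma layer_number_hitting_number_le: "layer_number V * hitting_number V E \<le> card V"
proof -
  let ?T = "\<lambda>i. {x \<in> V. layer_number (below x) = i}"
  have "layer_number V * hitting_number V E = (\<Sum>i<layer_number V. hitting_number V E)"
    by simp
  also have "\<dots> \<le> (\<Sum>i<layer_number V. card (?T i))"
    using hitting_number_le[OF finite_V] hitting_set_layer by (intro sum_mono) auto
  also have "\<dots> = card (\<Union>i<layer_number V. ?T i)"
    using finite_V by (intro card_UN_disjoint[symmetric]) auto
  also have "\<dots> \<le> card V"
    using finite_V by (intro card_mono) auto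
  finally show ?thesis .
qed

end

section \<open>Degrees into a layered set and double counting\<close>

context intersecting_two_incomparable_graph
begin

text \<open>Two vertices of equal rank cannot be \<open>\<sqsubseteq>\<close>-comparable, so in an
  independent set each of the \<open>k\<close> fibres is a \<open>\<prec>\<close>-chain, to which
  \<open>intersecting\<close> applies.\<close>

lemma card_neighbours_layered_le:
  assumes I: "independent_set V E I" and layered: "layered k I" and x: "x \<in> V - I"
  shows "card (neighbours E x \<inter> I) \<le> k * K (card V)"
proof -
  have I': "I \<subseteq> V" "\<And>a b. a \<in> I \<Longrightarrow> b \<in> I \<Longrightarrow> a \<noteq> b \<Longrightarrow> a \<sqsubseteq> b \<or> b \<sqsubseteq> a \<or> a \<prec> b \<or> b \<prec> a"
    using I independent_set_iff[of V] by auto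
  obtain r where r: "\<And>x. x \<in> I \<Longrightarrow> r x < k"
      "\<And>x y. x \<in> I \<Longrightarrow> y \<in> I \<Longrightarrow> x \<sqsubseteq> y \<Longrightarrow> x \<noteq> y \<Longrightarrow> r x < r y"
    using layered unfolding layered_def by metis
  have "card (neighbours E x \<inter> {y \<in> I. r y = i}) \<le> K (card V)" for i
  proof -
    have "\<exists>as. set as = {y \<in> I. r y = i} \<and> sorted_wrt (\<prec>) as"
    proof (rule finite_chain_list[OF _ _ prec_order])
      show "finite {y \<in> I. r y = i}" using I'(1) finite_V finite_subset by fastforce
      show "{y \<in> I. r y = i} \<subseteq> V" using I'(1) by blast
      show "a \<prec> b \<or> b \<prec> a" if "a \<in> {y \<in> I. r y = i}" "b \<in> {y \<in> I. r y = i}" "a \<noteq> b" for a b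
        using that I'(2)[of a b] r(2)[of a b] r(2)[of b a] by auto
    qed
    then obtain as where as: "set as = {y \<in> I. r y = i}" "sorted_wrt (\<prec>) as" by blast
    have "successively (\<prec>) as" using as(2) by (rule successively_if_sorted_wrt)
    moreover have "set as \<subseteq> V" "x \<in> V - set as" using as(1) I'(1) x by auto
    ultimately show ?thesis using intersecting[of as x] as(1) by simp
  qed
  then have "(\<Sum>i<k. card (neighbours E x \<inter> {y \<in> I. r y = i})) \<le> (\<Sum>i<k. K (card V))"
    by (intro sum_mono)
  moreover have "neighbours E x \<inter> I = (\<Union>i<k. neighbours E x \<inter> {y \<in> I. r y = i})"
    using r(1) by auto
  then have "card (neighbours E x \<inter> I) \<le> (\<Sum>i<k. card (neighbours E x \<inter> {y \<in> I. r y = i}))"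
    using card_UN_le[of "{..<k}"] by (metis finite_lessThan)
  ultimately show ?thesis by simp
qed

text \<open>Double counting of the edges between a maximum independent set \<open>I\<close> with
  fewest layers and its complement. A vertex of \<open>I\<close> has all its neighbours outside
  \<open>I\<close>, at least \<open>h - 1\<close> of them since its closed neighbourhood is hitting;
  a vertex outside has few neighbours in \<open>I\<close> by the layers.\<close>

lemma independence_number_hitting_number_le:
  "independence_number V E * (hitting_number V E - 1)
    \<le> (card V - independence_number V E) * (layer_number V * K (card V))"
proof -
  obtain I where I: "maximum_independent_set V E I" and lay: "layered (layer_number V) I"
    using layer_number_attained[of V] by blast
  have ind: "independent_set V E I" and cardI: "card I = independence_number V E"
    using I by (auto simp: maximum_independent_set_def)
  have IV: "I \<subseteq> V" using ind by (simp add: independent_set_def)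
  have fin: "finite I" "finite (V - I)" "finite (neighbours E v)" for v
    using IV finite_V neighbours_subset by (auto intro: finite_subset)
  have deg: "hitting_number V E - 1 \<le> card {x \<in> V - I. {v, x} \<in> E}" if "v \<in> I" for v
  proof -
    have "hitting_number V E \<le> card (insert v (neighbours E v))"
      using hitting_number_le[OF finite_V hitting_set_insert_neighbours] that IV by blast
    also have "\<dots> \<le> Suc (card (neighbours E v))"
      by (simp add: fin(3) card_insert_if)
    also have "neighbours E v = {x \<in> V - I. {v, x} \<in> E}"
      using neighbours_subset[of v] ind that
      by (auto simp: neighbours_def independent_set_def)
    finally show ?thesis by simp
  qed
  have "card I * (hitting_number V E - 1) = (\<Sum>v\<in>I. hitting_number V E - 1)" by simp
  also have "\<dots> \<le> (\<Sum>v\<in>I. card {x \<in> V - I. {v, x} \<in> E})"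
    by (intro sum_mono deg)
  also have "\<dots> = (\<Sum>x\<in>V - I. card {v \<in> I. {v, x} \<in> E})"
    by (rule sum_multicount_gen[OF fin(1,2)]) simp
  also have "\<dots> = (\<Sum>x\<in>V - I. card (neighbours E x \<inter> I))"
    by (intro sum.cong refl arg_cong[of _ _ card]) (auto simp: neighbours_def insert_commute)
  also have "\<dots> \<le> (\<Sum>x\<in>V - I. layer_number V * K (card V))"
    by (intro sum_mono card_neighbours_layered_le[OF ind lay])
  also have "\<dots> = (card V - card I) * (layer_number V * K (card V))"
    using IV fin(1) by (simp add: card_Diff_subset)
  finally show ?thesis by (simp add: cardI)
qed

section \<open>Numerical bounds on the hitting number\<close>

text \<open>The additive form comes from bounding \<open>(h - 1)\<^sup>2\<close> by
  \<open>(h - 1) * h\<close>. It holds for edgeless graphs too and serves both halves of the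
  theorem.\<close>

lemma hitting_number_le_sqrt:
  assumes "0 < \<beta>" "\<beta> < 1" "V \<noteq> {}" "\<beta> * real (card V) \<le> real (independence_number V E)"
  shows "real (hitting_number V E) \<le> 1 + sqrt ((1 - \<beta>) / \<beta> * real (card V) * real (K (card V)))"
proof -
  define n \<alpha> h k where "n = card V" and "\<alpha> = independence_number V E"
    and "h = hitting_number V E" and "k = K (card V)"
  have n: "0 < n" using assms(3) finite_V by (simp add: n_def card_gt_0_iff)
  have "\<beta> * real n \<le> real \<alpha>" using assms by (simp add: n_def \<alpha>_def)
  moreover from this have "0 < real \<alpha>" using n assms(1) by (smt (verit) mult_pos_pos of_nat_0_less_iff)
  ultimately have \<alpha>: "0 < real \<alpha>" "\<beta> * real n \<le> real \<alpha>" by blast+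
  \<comment> \<open>From \<open>n \<le> \<alpha> / \<beta>\<close>. The case split deals with
    truncated subtraction.\<close>
  have ratio: "real (n - \<alpha>) \<le> (1 - \<beta>) / \<beta> * real \<alpha>"
  proof (cases "\<alpha> \<le> n")
    case True
    then show ?thesis using \<alpha>(2) assms(1) by (simp add: of_nat_diff field_simps)
  next
    case False
    then show ?thesis using assms by simp
  qed
  \<comment> \<open>The extra factor \<open>h\<close> is there to absorb the layer number through
    \<open>layer_number V * h \<le> n\<close>.\<close>
  have "\<alpha> * (h - 1) * h \<le> (n - \<alpha>) * (layer_number V * k) * h"
    using independence_number_hitting_number_le by (simp add: n_def \<alpha>_def h_def k_def)
  also have "\<dots> = (n - \<alpha>) * k * (layer_number V * h)" by simp
  also have "\<dots> \<le> (n - \<alpha>) * k * n"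
    using layer_number_hitting_number_le by (simp add: n_def h_def)
  finally have "real (\<alpha> * (h - 1) * h) \<le> real ((n - \<alpha>) * k * n)" by (simp only: of_nat_le_iff)
  also have "\<dots> = real (n - \<alpha>) * (real k * real n)" by simp
  also have "\<dots> \<le> (1 - \<beta>) / \<beta> * real \<alpha> * (real k * real n)"
    using ratio by (intro mult_right_mono) auto
  finally have "real \<alpha> * (real (h - 1) * real h) \<le> real \<alpha> * ((1 - \<beta>) / \<beta> * real n * real k)"
    by (simp only: of_nat_mult mult_ac)
  then have "real (h - 1) * real h \<le> (1 - \<beta>) / \<beta> * real n * real k"
    using \<alpha>(1) by (simp only: mult_le_cancel_left_pos)
  moreover have "real (h - 1) * real (h - 1) \<le> real (h - 1) * real h"
    by (intro mult_left_mono) auto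
  ultimately have "real (h - 1) \<le> sqrt ((1 - \<beta>) / \<beta> * real n * real k)"
    by (intro real_le_rsqrt) (simp add: power2_eq_square)
  then show ?thesis by (simp add: n_def h_def k_def)
qed

text \<open>An edge \<open>{a, b}\<close> forces \<open>K (card V) \<ge> 1\<close>, by the
  one-vertex chain \<open>[b]\<close> and the vertex \<open>a\<close>, and keeps an independent set
  from being all of \<open>V\<close>, so that \<open>(1 - \<beta>) * n \<ge> 1\<close>. This turns
  the bound \<open>1 + sqrt\<close> into \<open>2 * sqrt\<close>.\<close>

lemma radicand_ge_1:
  assumes "0 < \<beta>" "\<beta> < 1" "E \<noteq> {}" "\<beta> * real (card V) \<le> real (independence_number V E)"
  shows "1 \<le> (1 - \<beta>) / \<beta> * real (card V) * real (K (card V))"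
proof -
  obtain a b where ab: "a \<in> V" "b \<in> V" "a \<noteq> b" "{a, b} \<in> E"
    using assms(3) edges by blast
  have "1 \<le> K (card V)"
    using intersecting[of "[b]" a] ab by (simp add: neighbours_def)
  moreover obtain I where I: "maximum_independent_set V E I"
    using ex_maximum_independent_set[OF finite_V] .
  have "I \<subset> V"
    using I ab by (auto simp: maximum_independent_set_def independent_set_def)
  then have "independence_number V E < card V"
    using I psubset_card_mono[OF finite_V, of I] by (simp add: maximum_independent_set_def)
  then have "1 \<le> (1 - \<beta>) * real (card V)"
    using assms(4) by (simp add: algebra_simps)
  then have "1 \<le> (1 - \<beta>) * real (card V) / \<beta>"
    using assms(1,2) by (simp add: pos_le_divide_eq)
  ultimately have "1 * 1 \<le> ((1 - \<beta>) * real (card V) / \<beta>) * real (K (card V))"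
    by (intro mult_mono) auto
  then show ?thesis by simp
qed

lemma hitting_number_le_2_sqrt:
  assumes "0 < \<beta>" "\<beta> < 1" "\<beta> * real (card V) \<le> real (independence_number V E)"
    and edgeless: "E = {} \<Longrightarrow> 1 \<le> 2 * sqrt ((1 - \<beta>) / \<beta> * real (card V) * real (K (card V)))"
  shows "real (hitting_number V E) \<le> 2 * sqrt ((1 - \<beta>) / \<beta> * real (card V) * real (K (card V)))"
proof (cases "E = {}")
  case True
  \<comment> \<open>For empty \<open>V\<close> the radicand is 0, against
    \<open>edgeless\<close>.\<close>
  have "V \<noteq> {}" using edgeless[OF True] by auto
  then obtain v where v: "v \<in> V" by blast
  have "hitting_number V E \<le> 1"
    using hitting_number_le[OF finite_V hitting_set_insert_neighbours[OF v]] True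
    by (simp add: neighbours_def)
  then show ?thesis using edgeless[OF True] by linarith
next
  case False
  then have "V \<noteq> {}" using edges by blast
  have "1 \<le> sqrt ((1 - \<beta>) / \<beta> * real (card V) * real (K (card V)))"
    using radicand_ge_1[OF assms(1,2) False assms(3)] by simp
  then show ?thesis
    using hitting_number_le_sqrt[OF assms(1,2) \<open>V \<noteq> {}\<close> assms(3)] by linarith
qed

end

text \<open>The side condition concerns edgeless graphs only. There \<open>K n = 0\<close> is
  possible, and the right-hand side is then 0, whereas a nonempty edgeless graph has hitting number
  1. The second half expresses \<open>h = o(n)\<close> uniformly over all graphs on \<open>n\<close>
  vertices.\<close>

theorem theorem4p6:
  fixes \<beta> :: real and K :: "nat \<Rightarrow> nat"
  assumes "0 < \<beta>" and "\<beta> < 1"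
  shows
    "(\<forall>(V :: 'a set) E sub prec n.
        intersecting_two_incomparable_graph V E sub prec K \<longrightarrow>
        card V = n \<longrightarrow>
        real (independence_number V E) \<ge> \<beta> * real n \<longrightarrow>
        (E = {} \<longrightarrow> 1 \<le> 2 * sqrt ((1 - \<beta>) / \<beta> * real n * real (K n))) \<longrightarrow>
        real (hitting_number V E) \<le> 2 * sqrt ((1 - \<beta>) / \<beta> * real n * real (K n))) \<and>
     ((\<lambda>n. real (K n)) \<in> o(\<lambda>n. real n) \<longrightarrow>
        (\<forall>\<epsilon>>0. \<exists>N. \<forall>(V :: 'a set) E sub prec n.
           intersecting_two_incomparable_graph V E sub prec K \<longrightarrow>
           card V = n \<longrightarrow>
           real (independence_number V E) \<ge> \<beta> * real n \<longrightarrow>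
           n \<ge> N \<longrightarrow>
           real (hitting_number V E) \<le> \<epsilon> * real n))"
proof (intro conjI allI impI)
  fix V :: "'a set" and E sub prec n
  assume G: "intersecting_two_incomparable_graph V E sub prec K" and n: "card V = n"
    and \<alpha>: "\<beta> * real n \<le> real (independence_number V E)"
    and edgeless: "E = {} \<longrightarrow> 1 \<le> 2 * sqrt ((1 - \<beta>) / \<beta> * real n * real (K n))"
  interpret intersecting_two_incomparable_graph V E sub prec K by (fact G)
  show "real (hitting_number V E) \<le> 2 * sqrt ((1 - \<beta>) / \<beta> * real n * real (K n))"
    using hitting_number_le_2_sqrt[OF assms] \<alpha> edgeless n by blast
next
  fix \<epsilon> :: real
  assume K: "(\<lambda>n. real (K n)) \<in> o(\<lambda>n. real n)" and \<epsilon>: "0 < \<epsilon>"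
  \<comment> \<open>Chosen so that \<open>(1 - \<beta>) / \<beta> * c\<close> is the square of
    \<open>\<epsilon> / 2\<close>; the square root then contributes at most half of
    \<open>\<epsilon> * n\<close>.\<close>
  define c where "c = \<beta> / (1 - \<beta>) * (\<epsilon> / 2)\<^sup>2"
  have "0 < c" using assms \<epsilon> by (simp add: c_def)
  then obtain N where N: "\<And>n. n \<ge> N \<Longrightarrow> real (K n) \<le> c * real n"
    using landau_o.smallD[OF K, of c] by (auto simp: eventually_at_top_linorder)
  \<comment> \<open>From \<open>n \<ge> 2 / \<epsilon>\<close> on, the other half of
    \<open>\<epsilon> * n\<close> absorbs the summand 1.\<close>
  obtain N' :: nat where N': "2 / \<epsilon> \<le> real N'" using real_arch_simple by blast
  show "\<exists>N. \<forall>(V :: 'a set) E sub prec n.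
           intersecting_two_incomparable_graph V E sub prec K \<longrightarrow>
           card V = n \<longrightarrow>
           real (independence_number V E) \<ge> \<beta> * real n \<longrightarrow>
           n \<ge> N \<longrightarrow>
           real (hitting_number V E) \<le> \<epsilon> * real n"
  \<comment> \<open>The 1 in the maximum excludes the empty graph, whose hitting number is
    unspecified.\<close>
  proof (intro exI[of _ "max N (max N' 1)"] allI impI)
    fix V :: "'a set" and E sub prec n
    assume G: "intersecting_two_incomparable_graph V E sub prec K" and n: "card V = n"
      and \<alpha>: "\<beta> * real n \<le> real (independence_number V E)"
      and large: "max N (max N' 1) \<le> n"
    interpret intersecting_two_incomparable_graph V E sub prec K by (fact G)
    have "V \<noteq> {}" using n large by auto
    have "2 / \<epsilon> \<le> real n" using N' large by linarith
    then have one: "1 \<le> \<epsilon> / 2 * real n" using \<epsilon> by (simp add: field_simps)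
    have "(1 - \<beta>) / \<beta> * real n * real (K n) \<le> (1 - \<beta>) / \<beta> * real n * (c * real n)"
      using N[of n] large assms by (intro mult_left_mono) auto
    moreover have "(1 - \<beta>) / \<beta> * c = (\<epsilon> / 2)\<^sup>2"
      using assms by (simp add: c_def)
    then have "(1 - \<beta>) / \<beta> * real n * (c * real n) = (\<epsilon> / 2 * real n)\<^sup>2"
      by (metis (no_types, lifting) mult.assoc mult.commute power2_eq_square)
    ultimately have "(1 - \<beta>) / \<beta> * real n * real (K n) \<le> (\<epsilon> / 2 * real n)\<^sup>2"
      by simp
    then have "sqrt ((1 - \<beta>) / \<beta> * real n * real (K n)) \<le> \<epsilon> / 2 * real n"
      using \<epsilon> by (intro real_le_lsqrt) auto
    with one show "real (hitting_number V E) \<le> \<epsilon> * real n"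
      using hitting_number_le_sqrt[OF assms \<open>V \<noteq> {}\<close>] \<alpha> n by (simp add: field_simps)
  qed
qed

end
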